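(* Let $\{x_k\}_{k\ge0}$ be generated by the stochastic block Bregman projection (SBBP) method under the sampling rule described in the context, with $t_k$ at every iteration given by the exact projective stepsize, or $t_k$ at every iteration given by the block adaptive extrapolated stepsize (both defined in the context). Let $L$ and $L_\tau^{\mathrm{block}}$ be the stochastic and block smooth regularity constants defined in the context. (a) For every integer $K\ge1$, $$\min_{0\le k\le K-1}\mathbb{E}\|\nabla F(x_k)\|^2\le\frac{2LL_{\max}^2L_\tau^{\mathrm{block}}}{\mu K}\,\mathrm{dist}_\psi^{x_0^*}(x_0,\bar X)^2.$$ (b) Assume further that $F$ satisfies, for some $\gamma>0$, the PL inequality $\sqrt{\frac{\gamma\mu}{2}}\cdot\sqrt{F(x)-\bar F}\le\|\nabla F(x)\|$ for all $x\in\mathbb{R}^n$. Then for every integer $K\ge1$ the average $\bar x_K=\frac1K\sum_{k=0}^{K-1}x_k$ satisfies $$\mathbb{E}\left[F(\bar x_K)-\bar F\right]\le\frac{4LL_{\max}^2L_\tau^{\mathrm{block}}}{\mu^2\gamma K}\,\mathrm{dist}_\psi^{x_0^*}(x_0,\bar X)^2.$$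
   Context: Notation: $[m]=\{1,\dots,m\}$; $\|\cdot\|$ is the Euclidean norm. $C_1,\dots,C_m\subset\mathbb{R}^n$ are closed convex sets with $C=\bigcap_{i=1}^mC_i\ne\emptyset$. Problem data: $\psi:\mathbb{R}^n\to\mathbb{R}$ is $\mu$-strongly convex ($\mu>0$); each $f_i:\mathbb{R}^n\to\mathbb{R}$, $i\in[m]$, is convex and differentiable with $L_i$-Lipschitz gradient, $L_i>0$, and satisfies $f_i(x)\ge0$ for all $x$, with $f_i(x)=0$ if and only if $x\in C_i$; $L_{\max}=\max_{i\in[m]}L_i$; $F(x)=\frac1m\sum_{i=1}^mf_i(x)$; $\bar F=\min F$ and $\bar X=\arg\min_{x\in\mathbb{R}^n}F(x)$ (nonempty; here $\bar X=C$). $\psi^*$ is the Fenchel conjugate of $\psi$ (differentiable with $1/\mu$-Lipschitz gradient). For $x^*\in\partial\psi(x)$, $D_\psi^{x^*}(x,y)=\psi(y)-\psi(x)-\langle x^*,y-x\rangle$ and $\mathrm{dist}_\psi^{x^*}(x,\bar X)^2=\inf_{z\in\bar X}D_\psi^{x^*}(x,z)$. Sampling rule: fix $\tau\in\{1,\dots,m\}$. At each iteration $k\ge0$ a random subset $J_k\subset[m]$ with $|J_k|=\tau$ is drawn from a fixed distribution with $\mathbf P(i\in J_k)=\tau/m$ for all $i\in[m]$, independently of $J_0,\dots,J_{k-1}$; weights are $w_{i,k}=1/\tau$, $i\in J_k$. SBBP method: $x_0\in\mathbb{R}^n$, $x_0^*\in\partial\psi(x_0)$, $\alpha_k=\sum_{i\in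 J_k}w_{i,k}\nabla f_i(x_k)$, and $x_{k+1}^*=x_k^*-t_k\alpha_k$, $x_{k+1}=\nabla\psi^*(x_{k+1}^* )$. Stepsizes: with $\beta_k=\langle\alpha_k,x_k\rangle-\sum_{i\in J_k}\frac{w_{i,k}}{L_i}\|\nabla f_i(x_k)\|^2$, the exact projective stepsize is a solution $t_k$ of $\min_{t\in\mathbb{R}}\psi^*(x_k^*-t\alpha_k)+t\beta_k$. The block adaptive extrapolated stepsize is $t_k=\frac{\mu}{L_{\max}L_{\mathrm{adapt}}^{k,\tau}}$ with $L_{\mathrm{adapt}}^{k,\tau}=\frac{\|\sum_{i\in J_k}w_{i,k}\nabla f_i(x_k)\|^2}{\sum_{i\in J_k}w_{i,k}\|\nabla f_i(x_k)\|^2}$. If $\nabla f_i(x_k)=0$ for all $i\in J_k$, then $\alpha_k=0$ and the stepsize is irrelevant ($x_{k+1}^*=x_k^*$, $x_{k+1}=x_k$). Regularity constants (convention $0/0=0$): $$L=\sup_{x\in\mathbb{R}^n}\frac{\|\frac1m\sum_{i=1}^m\nabla f_i(x)\|^2}{\frac1m\sum_{i=1}^m\|\nabla f_i(x)\|^2},\qquad L_\tau^{\mathrm{block}}=\sup_{k\ge0}\frac{\|\sum_{i\in J_k}w_{i,k}\nabla f_i(x_k)\|^2}{\sum_{i\in J_k}w_{i,k}\|\nabla f_i(x_k)\|^2},$$ the second supremum being also over all realizations of the random samples, so that $L_\tau^{\mathrm{block}}$ is a deterministic constant; both are at most $1$. *)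

theory Defs
  imports "HOL-Probability.Probability"
begin

section \<open>Convex analysis\<close>

definition grad :: "('a::real_inner \<Rightarrow> real) \<Rightarrow> 'a \<Rightarrow> 'a" where
  "grad g x = (THE D. GDERIV g x :> D)"

definition strongly_convex :: "real \<Rightarrow> ('a::real_inner \<Rightarrow> real) \<Rightarrow> bool" where
  "strongly_convex \<mu> \<psi> \<longleftrightarrow>
     (\<forall>x y. \<forall>u\<in>{0..1}. \<psi> (u *\<^sub>R x + (1 - u) *\<^sub>R y)
        \<le> u * \<psi> x + (1 - u) * \<psi> y - \<mu> / 2 * u * (1 - u) * (norm (x - y))\<^sup>2)"

definition subdifferential :: "('a::real_inner \<Rightarrow> real) \<Rightarrow> 'a \<Rightarrow> 'a set" where
  "subdifferential \<psi> x = {xs. \<forall>y. \<psi> y \<ge> \<psi> x + xs \<bullet> (y - x)}"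

text \<open>The supremum is taken in the reals; it is the usual conjugate whenever the set is
  bounded above, which holds at every point if \<open>\<psi>\<close> is finite and strongly convex on a
  Euclidean space.\<close>

definition fenchel_conjugate :: "('a::real_inner \<Rightarrow> real) \<Rightarrow> 'a \<Rightarrow> real" where
  "fenchel_conjugate \<psi> xs = (SUP x. xs \<bullet> x - \<psi> x)"

definition bregman :: "('a::real_inner \<Rightarrow> real) \<Rightarrow> 'a \<Rightarrow> 'a \<Rightarrow> 'a \<Rightarrow> real" where
  "bregman \<psi> xs x y = \<psi> y - \<psi> x - xs \<bullet> (y - x)"

text \<open>This is the square of the Bregman distance from \<open>x\<close> to the set \<open>X\<close>.\<close>

definition bregman_dist_sq :: "('a::real_inner \<Rightarrow> real) \<Rightarrow> 'a \<Rightarrow> 'a \<Rightarrow> 'a set \<Rightarrow> real" where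
  "bregman_dist_sq \<psi> xs x X = (INF z\<in>X. bregman \<psi> xs x z)"

section \<open>Finite-sum objective\<close>

definition avg_fun :: "nat \<Rightarrow> (nat \<Rightarrow> 'a \<Rightarrow> real) \<Rightarrow> 'a \<Rightarrow> real" where
  "avg_fun m f x = 1 / real m * (\<Sum>i\<in>{1..m}. f i x)"

definition argmin_set :: "('a \<Rightarrow> real) \<Rightarrow> 'a set" where
  "argmin_set g = {x. is_arg_min g (\<lambda>_. True) x}"

text \<open>In the two quotients below, \<open>0 / 0 = 0\<close>. By Jensen's inequality they lie in \<open>{0..1}\<close>,
  so that the real suprema formed from them are genuine suprema.\<close>

definition smooth_regularity :: "nat \<Rightarrow> (nat \<Rightarrow> 'a::real_inner \<Rightarrow> real) \<Rightarrow> real" where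
  "smooth_regularity m f =
     (SUP x. (norm ((1 / real m) *\<^sub>R (\<Sum>i\<in>{1..m}. grad (f i) x)))\<^sup>2
           / (1 / real m * (\<Sum>i\<in>{1..m}. (norm (grad (f i) x))\<^sup>2)))"

section \<open>The block Bregman projection method\<close>

text \<open>\<open>S\<close> is the sampled block; all weights are \<open>1 / \<tau>\<close>.\<close>

definition block_grad :: "(nat \<Rightarrow> 'a::real_inner \<Rightarrow> real) \<Rightarrow> nat \<Rightarrow> nat set \<Rightarrow> 'a \<Rightarrow> 'a" where
  "block_grad f \<tau> S x = (\<Sum>i\<in>S. (1 / real \<tau>) *\<^sub>R grad (f i) x)"

definition block_offset ::
  "(nat \<Rightarrow> 'a::real_inner \<Rightarrow> real) \<Rightarrow> (nat \<Rightarrow> real) \<Rightarrow> nat \<Rightarrow> nat set \<Rightarrow> 'a \<Rightarrow> real" where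
  "block_offset f Lip \<tau> S x =
     block_grad f \<tau> S x \<bullet> x - (\<Sum>i\<in>S. (1 / real \<tau>) / Lip i * (norm (grad (f i) x))\<^sup>2)"

definition block_ratio :: "(nat \<Rightarrow> 'a::real_inner \<Rightarrow> real) \<Rightarrow> nat \<Rightarrow> nat set \<Rightarrow> 'a \<Rightarrow> real" where
  "block_ratio f \<tau> S x =
     (norm (\<Sum>i\<in>S. (1 / real \<tau>) *\<^sub>R grad (f i) x))\<^sup>2
       / (\<Sum>i\<in>S. 1 / real \<tau> * (norm (grad (f i) x))\<^sup>2)"

definition block_regularity ::
  "'w measure \<Rightarrow> (nat \<Rightarrow> 'a::real_inner \<Rightarrow> real) \<Rightarrow> nat \<Rightarrow> (nat \<Rightarrow> 'w \<Rightarrow> nat set)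
    \<Rightarrow> (nat \<Rightarrow> 'w \<Rightarrow> 'a) \<Rightarrow> real" where
  "block_regularity M f \<tau> J x =
     (SUP (k, \<omega>)\<in>UNIV \<times> space M. block_ratio f \<tau> (J k \<omega>) (x k \<omega>))"

text \<open>For each \<open>k\<close>, independence of \<open>J k\<close> from \<open>J 0, \<dots>, J (k - 1)\<close> is the same as mutual
  independence of the whole family.\<close>

definition block_sampling ::
  "'w measure \<Rightarrow> nat \<Rightarrow> nat \<Rightarrow> (nat \<Rightarrow> 'w \<Rightarrow> nat set) \<Rightarrow> bool" where
  "block_sampling M m \<tau> J \<longleftrightarrow>
     prob_space.indep_vars M (\<lambda>_. count_space (Pow {1..m})) J UNIV \<and>
     (\<forall>k. distr M (count_space (Pow {1..m})) (J k) = distr M (count_space (Pow {1..m})) (J 0)) \<and>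
     (\<forall>k. \<forall>\<omega>\<in>space M. card (J k \<omega>) = \<tau>) \<and>
     (\<forall>k. \<forall>i\<in>{1..m}. measure M {\<omega> \<in> space M. i \<in> J k \<omega>} = real \<tau> / real m)"

definition sbbp ::
  "'w measure \<Rightarrow> ('a::real_inner \<Rightarrow> real) \<Rightarrow> (nat \<Rightarrow> 'a \<Rightarrow> real) \<Rightarrow> nat \<Rightarrow> (nat \<Rightarrow> 'w \<Rightarrow> nat set)
    \<Rightarrow> (nat \<Rightarrow> 'w \<Rightarrow> real) \<Rightarrow> 'a \<Rightarrow> 'a \<Rightarrow> (nat \<Rightarrow> 'w \<Rightarrow> 'a) \<Rightarrow> (nat \<Rightarrow> 'w \<Rightarrow> 'a) \<Rightarrow> bool" where
  "sbbp M \<psi> f \<tau> J t x\<^sub>0 xs\<^sub>0 x xs \<longleftrightarrow>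
     xs\<^sub>0 \<in> subdifferential \<psi> x\<^sub>0 \<and>
     (\<forall>\<omega>\<in>space M. x 0 \<omega> = x\<^sub>0 \<and> xs 0 \<omega> = xs\<^sub>0 \<and>
        (\<forall>k. xs (Suc k) \<omega> = xs k \<omega> - t k \<omega> *\<^sub>R block_grad f \<tau> (J k \<omega>) (x k \<omega>) \<and>
             x (Suc k) \<omega> = grad (fenchel_conjugate \<psi>) (xs (Suc k) \<omega>)))"

text \<open>The minimizer in the exact rule need not be unique. The second conjunct says that the
  one used at iteration \<open>k\<close> is selected from the information available then, namely the
  blocks drawn up to iteration \<open>k\<close>; in particular it does not anticipate later samples.\<close>

definition exact_stepsize ::
  "'w measure \<Rightarrow> ('a::real_inner \<Rightarrow> real) \<Rightarrow> (nat \<Rightarrow> 'a \<Rightarrow> real) \<Rightarrow> (nat \<Rightarrow> real) \<Rightarrow> nat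
    \<Rightarrow> (nat \<Rightarrow> 'w \<Rightarrow> nat set) \<Rightarrow> (nat \<Rightarrow> 'w \<Rightarrow> 'a) \<Rightarrow> (nat \<Rightarrow> 'w \<Rightarrow> 'a) \<Rightarrow> (nat \<Rightarrow> 'w \<Rightarrow> real) \<Rightarrow> bool" where
  "exact_stepsize M \<psi> f Lip \<tau> J x xs t \<longleftrightarrow>
     (\<forall>k. \<forall>\<omega>\<in>space M.
        is_arg_min
          (\<lambda>s. fenchel_conjugate \<psi> (xs k \<omega> - s *\<^sub>R block_grad f \<tau> (J k \<omega>) (x k \<omega>))
               + s * block_offset f Lip \<tau> (J k \<omega>) (x k \<omega>))
          (\<lambda>_. True) (t k \<omega>)) \<and>
     (\<forall>k. \<forall>\<omega>\<in>space M. \<forall>\<omega>'\<in>space M. (\<forall>j\<le>k. J j \<omega> = J j \<omega>') \<longrightarrow> t k \<omega> = t k \<omega>')"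

text \<open>If all sampled gradients vanish, the update direction is zero and the stepsize is
  left unconstrained.\<close>

definition adaptive_stepsize ::
  "'w measure \<Rightarrow> real \<Rightarrow> (nat \<Rightarrow> 'a::real_inner \<Rightarrow> real) \<Rightarrow> real \<Rightarrow> nat
    \<Rightarrow> (nat \<Rightarrow> 'w \<Rightarrow> nat set) \<Rightarrow> (nat \<Rightarrow> 'w \<Rightarrow> 'a) \<Rightarrow> (nat \<Rightarrow> 'w \<Rightarrow> real) \<Rightarrow> bool" where
  "adaptive_stepsize M \<mu> f Lmax \<tau> J x t \<longleftrightarrow>
     (\<forall>k. \<forall>\<omega>\<in>space M. (\<exists>i\<in>J k \<omega>. grad (f i) (x k \<omega>) \<noteq> 0) \<longrightarrow>
        t k \<omega> = \<mu> / (Lmax * block_ratio f \<tau> (J k \<omega>) (x k \<omega>)))"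

end

theory Submission
  imports Defs
begin

text \<open>For \<open>z\<close> in the intersection of the \<open>C i\<close>, cocoercivity of the gradients and
  \<open>1/\<mu>\<close>-smoothness of the conjugate show that a step sampling the block \<open>S\<close> at \<open>x\<close> lowers the
  Bregman distance to \<open>z\<close> by at least \<open>\<mu> / (2 Lmax\<^sup>2 Lblock)\<close> times the mean of
  \<open>\<parallel>\<nabla>f\<^sub>i(x)\<parallel>\<^sup>2\<close> over \<open>S\<close>. Summing over the steps telescopes. Since \<open>J k\<close> is independent of
  the current iterate, the expected block mean is the expected mean over all indices, which
  dominates \<open>E \<parallel>\<nabla>F(x\<^sub>k)\<parallel>\<^sup>2 / L\<close>. For (b), combine this with convexity of \<open>F\<close> and the PL
  inequality.\<close>

section \<open>Smooth convex functions\<close>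

lemma grad_eqI:
  assumes "GDERIV g x :> D"
  shows "grad g x = D"
  unfolding grad_def
proof (rule the_equality)
  fix D' assume "GDERIV g x :> D'"
  then have "(\<lambda>h. h \<bullet> D') = (\<lambda>h. h \<bullet> D)"
    using assms has_derivative_unique unfolding gderiv_def by blast
  then have "(D' - D) \<bullet> (D' - D) = 0"
    by (metis inner_diff_right right_minus_eq)
  then show "D' = D" by simp
qed (fact assms)

text \<open>Riesz representation in finite dimension: the derivative is a linear functional,
  represented by its adjoint at 1. Hence the definite description in \<open>grad\<close>
  denotes.\<close>

lemma GDERIV_grad:
  fixes g :: "'a::euclidean_space \<Rightarrow> real"
  assumes "g differentiable (at x)"
  shows "GDERIV g x :> grad g x"
proof -
  obtain g' where g': "(g has_derivative g') (at x)"
    using assms unfolding differentiable_def by blast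
  then have "linear g'" by (rule has_derivative_linear)
  then have "g' = (\<lambda>h. h \<bullet> adjoint g' 1)"
    using adjoint_works[of g' _ 1] by (auto simp: fun_eq_iff)
  with g' have "GDERIV g x :> adjoint g' 1"
    unfolding gderiv_def by simp
  then show ?thesis using grad_eqI by metis
qed

lemma DERIV_along_line:
  fixes g :: "'a::euclidean_space \<Rightarrow> real"
  assumes "\<And>z. g differentiable (at z)"
  shows "((\<lambda>s. g (x + s *\<^sub>R d)) has_real_derivative grad g (x + s *\<^sub>R d) \<bullet> d) (at s)"
proof -
  have "((\<lambda>s. x + s *\<^sub>R d) has_derivative (\<lambda>h. h *\<^sub>R d)) (at s)"
    by (auto intro!: derivative_eq_intros)
  moreover have "(g has_derivative (\<lambda>h. h \<bullet> grad g (x + s *\<^sub>R d))) (at (x + s *\<^sub>R d))"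
    using GDERIV_grad[OF assms] unfolding gderiv_def .
  ultimately have "((\<lambda>s. g (x + s *\<^sub>R d)) has_derivative
      (\<lambda>h. (h *\<^sub>R d) \<bullet> grad g (x + s *\<^sub>R d))) (at s)"
    by (rule has_derivative_compose)
  moreover have "(\<lambda>h. (h *\<^sub>R d) \<bullet> grad g (x + s *\<^sub>R d)) = (*) (grad g (x + s *\<^sub>R d) \<bullet> d)"
    by (auto simp: fun_eq_iff inner_commute)
  ultimately show ?thesis unfolding has_field_derivative_def by simp
qed

text \<open>Along the line through x and y, g becomes a convex function of one real variable; its
  tangent at 0, evaluated at 1, is the claim.\<close>

lemma convex_above_tangent:
  fixes g :: "'a::euclidean_space \<Rightarrow> real"
  assumes "convex_on UNIV g" and diff: "\<And>z. g differentiable (at z)"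
  shows "g y \<ge> g x + grad g x \<bullet> (y - x)"
proof -
  let ?h = "\<lambda>s::real. g (x + s *\<^sub>R (y - x))"
  have "convex_on UNIV ?h"
  proof (rule convex_onI)
    fix t a b :: real assume "0 < t" "t < 1"
    have "x + ((1 - t) *\<^sub>R a + t *\<^sub>R b) *\<^sub>R (y - x)
        = (1 - t) *\<^sub>R (x + a *\<^sub>R (y - x)) + t *\<^sub>R (x + b *\<^sub>R (y - x))"
      by (simp add: algebra_simps)
    then show "?h ((1 - t) *\<^sub>R a + t *\<^sub>R b) \<le> (1 - t) * ?h a + t * ?h b"
      using convex_onD[OF assms(1), of t] \<open>0 < t\<close> \<open>t < 1\<close> by simp
  qed simp
  moreover have "(?h has_real_derivative grad g x \<bullet> (y - x)) (at 0)"
    using DERIV_along_line[OF diff, of x "y - x" 0] by simp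
  ultimately show ?thesis
    using convex_on_imp_above_tangent[of UNIV ?h 0 1 "grad g x \<bullet> (y - x)"] by simp
qed

lemma descent_lemma:
  fixes g :: "'a::euclidean_space \<Rightarrow> real"
  assumes diff: "\<And>z. g differentiable (at z)" and lip: "lipschitz_on l UNIV (grad g)"
  shows "g (x + d) \<le> g x + grad g x \<bullet> d + l / 2 * (norm d)\<^sup>2"
proof -
  \<comment> \<open>\<open>?h\<close> is g along the segment minus the varying part of its quadratic
    majorant. The Lipschitz bound makes its derivative nonpositive on [0, 1], so comparing 0 and 1
    replaces an integration of the gradient.\<close>
  let ?h = "\<lambda>s. g (x + s *\<^sub>R d) - s * (grad g x \<bullet> d) - l / 2 * s\<^sup>2 * (norm d)\<^sup>2"
  let ?h' = "\<lambda>s. grad g (x + s *\<^sub>R d) \<bullet> d - grad g x \<bullet> d - l * s * (norm d)\<^sup>2"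
  have "?h 0 \<ge> ?h 1"
  proof (rule DERIV_nonpos_imp_nonincreasing[where f = ?h])
    fix s :: real assume "0 \<le> s"
    have "(?h has_real_derivative ?h' s) (at s)"
      by (auto intro!: derivative_eq_intros DERIV_along_line[OF diff])
    moreover have "?h' s \<le> 0"
    proof -
      have "grad g (x + s *\<^sub>R d) \<bullet> d - grad g x \<bullet> d
          \<le> norm (grad g (x + s *\<^sub>R d) - grad g x) * norm d"
        by (metis inner_diff_left norm_cauchy_schwarz)
      also have "\<dots> \<le> l * norm (s *\<^sub>R d) * norm d"
        using lipschitz_onD[OF lip, of "x + s *\<^sub>R d" x]
        by (intro mult_right_mono) (auto simp: dist_norm)
      finally show ?thesis using \<open>0 \<le> s\<close> by (simp add: power2_eq_square mult_ac)
    qed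
    ultimately show "\<exists>y. (?h has_real_derivative y) (at s) \<and> y \<le> 0" by blast
  qed simp
  then show ?thesis by simp
qed

text \<open>A gradient step of length 1 / l lowers g by at least the left-hand side, and g cannot
  fall below 0.\<close>

lemma nonneg_smooth_bound:
  fixes g :: "'a::euclidean_space \<Rightarrow> real"
  assumes diff: "\<And>z. g differentiable (at z)" and lip: "lipschitz_on l UNIV (grad g)"
    and "l > 0" and nonneg: "\<And>z. g z \<ge> 0"
  shows "(norm (grad g x))\<^sup>2 / (2 * l) \<le> g x"
proof -
  have "0 \<le> g (x + (- 1 / l) *\<^sub>R grad g x)" by (rule nonneg)
  also have "\<dots> \<le> g x + grad g x \<bullet> ((- 1 / l) *\<^sub>R grad g x)
      + l / 2 * (norm ((- 1 / l) *\<^sub>R grad g x))\<^sup>2"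
    by (rule descent_lemma[OF diff lip])
  also have "\<dots> = g x - (norm (grad g x))\<^sup>2 / (2 * l)"
    using \<open>l > 0\<close> by (simp add: dot_square_norm power_mult_distrib power2_eq_square field_simps)
  finally show ?thesis by simp
qed

text \<open>Evaluate both the descent lemma at \<open>z\<close> and the tangent bound at \<open>x\<close> in the point
  \<open>z + grad g x / l\<close>.\<close>

lemma cocoercive_at_zero:
  fixes g :: "'a::euclidean_space \<Rightarrow> real"
  assumes conv: "convex_on UNIV g"
    and diff: "\<And>z. g differentiable (at z)" and lip: "lipschitz_on l UNIV (grad g)"
    and "l > 0" and nonneg: "\<And>z. g z \<ge> 0" and "g z = 0"
  shows "(norm (grad g x))\<^sup>2 / l \<le> grad g x \<bullet> (x - z)"
proof -
  have "grad g z = 0"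
    using nonneg_smooth_bound[OF diff lip \<open>l > 0\<close> nonneg, of z] \<open>g z = 0\<close> \<open>l > 0\<close>
    by (simp add: divide_le_0_iff)
  let ?w = "(1 / l) *\<^sub>R grad g x"
  have "g x + grad g x \<bullet> (z + ?w - x) \<le> g (z + ?w)"
    by (rule convex_above_tangent[OF conv diff])
  also have "\<dots> \<le> g z + grad g z \<bullet> ?w + l / 2 * (norm ?w)\<^sup>2"
    by (rule descent_lemma[OF diff lip])
  also have "\<dots> = (norm (grad g x))\<^sup>2 / (2 * l)"
    using \<open>g z = 0\<close> \<open>grad g z = 0\<close> \<open>l > 0\<close>
    by (simp add: power_mult_distrib power2_eq_square field_simps)
  finally have "g x + grad g x \<bullet> (z - x) + (norm (grad g x))\<^sup>2 / l
      \<le> (norm (grad g x))\<^sup>2 / (2 * l)"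
    by (simp add: inner_diff_right inner_add_right dot_square_norm)
  \<comment> \<open>The lower bound on \<open>g x\<close> supplies the second half of the constant:
    1 / (2 l) + 1 / (2 l) = 1 / l.\<close>
  with nonneg_smooth_bound[OF diff lip \<open>l > 0\<close> nonneg, of x] show ?thesis
    by (simp add: inner_diff_right)
qed

lemma grad_avg_fun:
  fixes f :: "nat \<Rightarrow> 'a::euclidean_space \<Rightarrow> real"
  assumes "\<And>i. i \<in> {1..m} \<Longrightarrow> f i differentiable (at x)"
  shows "grad (avg_fun m f) x = (1 / real m) *\<^sub>R (\<Sum>i\<in>{1..m}. grad (f i) x)"
proof (rule grad_eqI)
  have d: "(f i has_derivative (\<lambda>h. h \<bullet> grad (f i) x)) (at x)" if "i \<in> {1..m}" for i
    using GDERIV_grad[OF assms[OF that]] unfolding gderiv_def .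
  have "((\<lambda>y. 1 / real m * (\<Sum>i\<in>{1..m}. f i y)) has_derivative
      (\<lambda>h. 1 / real m * (\<Sum>i\<in>{1..m}. h \<bullet> grad (f i) x))) (at x)"
    by (intro has_derivative_mult_right has_derivative_sum d)
  then show "GDERIV (avg_fun m f) x :> (1 / real m) *\<^sub>R (\<Sum>i\<in>{1..m}. grad (f i) x)"
    unfolding gderiv_def avg_fun_def[abs_def] by (simp add: inner_sum_right)
qed

section \<open>The conjugate of a strongly convex function\<close>

lemma strongly_convex_imp_convex:
  assumes "strongly_convex \<mu> \<psi>" "\<mu> \<ge> 0"
  shows "convex_on UNIV \<psi>"
proof (rule convex_onI)
  fix t :: real and x y assume t: "0 < t" "t < 1"
  have "\<psi> ((1 - t) *\<^sub>R x + t *\<^sub>R y)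
      \<le> t * \<psi> y + (1 - t) * \<psi> x - \<mu> / 2 * t * (1 - t) * (norm (y - x))\<^sup>2"
    using assms(1) t unfolding strongly_convex_def
    by (metis add.commute atLeastAtMost_iff less_imp_le)
  moreover have "0 \<le> \<mu> / 2 * t * (1 - t) * (norm (y - x))\<^sup>2"
    using t assms(2) by simp
  ultimately show "\<psi> ((1 - t) *\<^sub>R x + t *\<^sub>R y) \<le> (1 - t) * \<psi> x + t * \<psi> y" by linarith
qed simp

text \<open>Compare the subgradient inequality with strong convexity at the point a fraction u of
  the way from x to y, divide by u, and let u tend to 0 from the right.\<close>

lemma strong_subgradient_inequality:
  assumes sc: "strongly_convex \<mu> \<psi>" and sub: "xs \<in> subdifferential \<psi> x"
  shows "\<psi> y \<ge> \<psi> x + xs \<bullet> (y - x) + \<mu> / 2 * (norm (y - x))\<^sup>2"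
proof -
  let ?c = "\<mu> / 2 * (norm (y - x))\<^sup>2"
  let ?r = "\<psi> y - \<psi> x - xs \<bullet> (y - x)"
  have le: "(1 - u) * ?c \<le> ?r" if u: "0 < u" "u < 1" for u :: real
  proof -
    have "\<psi> x + xs \<bullet> (u *\<^sub>R y + (1 - u) *\<^sub>R x - x) \<le> \<psi> (u *\<^sub>R y + (1 - u) *\<^sub>R x)"
      using sub unfolding subdifferential_def by simp
    also have "\<dots> \<le> u * \<psi> y + (1 - u) * \<psi> x - \<mu> / 2 * u * (1 - u) * (norm (y - x))\<^sup>2"
      using sc u unfolding strongly_convex_def by simp
    also have "u *\<^sub>R y + (1 - u) *\<^sub>R x - x = u *\<^sub>R (y - x)"
      by (simp add: algebra_simps)
    finally have "u * ((1 - u) * ?c) \<le> u * ?r"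
      by (simp add: algebra_simps)
    with u(1) show ?thesis by simp
  qed
  have "((\<lambda>u::real. (1 - u) * ?c) \<longlongrightarrow> (1 - 0) * ?c) (at_right 0)"
    by (intro tendsto_intros)
  then have "(1 - 0) * ?c \<le> ?r"
  proof (rule tendsto_upperbound)
    show "\<forall>\<^sub>F u::real in at_right 0. (1 - u) * ?c \<le> ?r"
      using le by (auto simp: eventually_at_right_field intro!: exI[of _ 1])
  qed simp
  then show ?thesis by simp
qed

text \<open>Tilting \<psi> by xs keeps its quadratic growth, so a minimum over a large enough ball
  is global, and at a global minimizer xs is a subgradient. This makes the conjugate finite and
  attained at every point.\<close>

lemma strongly_convex_subgradient_surj:
  fixes \<psi> :: "'a::euclidean_space \<Rightarrow> real"
  assumes sc: "strongly_convex \<mu> \<psi>" and "\<mu> > 0" and sub: "xs\<^sub>0 \<in> subdifferential \<psi> x\<^sub>0"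
  obtains x where "xs \<in> subdifferential \<psi> x"
proof -
  let ?\<phi> = "\<lambda>y. \<psi> y - xs \<bullet> y"
  \<comment> \<open>Beyond distance r from \<open>x\<^sub>0\<close>, the quadratic growth of \<psi>
    with constant \<mu> / 2 outweighs the linear term of slope
    \<open>xs - xs\<^sub>0\<close>.\<close>
  define r where "r = 2 * norm (xs - xs\<^sub>0) / \<mu>"
  have "r \<ge> 0" using \<open>\<mu> > 0\<close> by (simp add: r_def)
  have "continuous_on UNIV \<psi>"
    using strongly_convex_imp_convex[OF sc] \<open>\<mu> > 0\<close> by (intro convex_on_continuous) auto
  then have "continuous_on (cball x\<^sub>0 r) ?\<phi>"
    by (intro continuous_intros) (auto intro: continuous_on_subset)
  then obtain x where x: "x \<in> cball x\<^sub>0 r" and min: "\<And>y. y \<in> cball x\<^sub>0 r \<Longrightarrow> ?\<phi> x \<le> ?\<phi> y"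
    using continuous_attains_inf[of "cball x\<^sub>0 r" ?\<phi>] \<open>r \<ge> 0\<close> by auto
  have "?\<phi> x \<le> ?\<phi> y" for y
  proof (cases "y \<in> cball x\<^sub>0 r")
    case False
    then have r: "2 * norm (xs - xs\<^sub>0) \<le> \<mu> * norm (y - x\<^sub>0)"
      using \<open>\<mu> > 0\<close> by (simp add: r_def dist_norm norm_minus_commute field_simps)
    have "(xs - xs\<^sub>0) \<bullet> (y - x\<^sub>0) \<le> norm (xs - xs\<^sub>0) * norm (y - x\<^sub>0)"
      by (rule norm_cauchy_schwarz)
    also have "\<dots> \<le> \<mu> / 2 * norm (y - x\<^sub>0) * norm (y - x\<^sub>0)"
      using r by (intro mult_right_mono) auto
    finally have "(xs - xs\<^sub>0) \<bullet> (y - x\<^sub>0) \<le> \<mu> / 2 * (norm (y - x\<^sub>0))\<^sup>2"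
      by (simp add: power2_eq_square mult_ac)
    with strong_subgradient_inequality[OF sc sub, of y] have "?\<phi> x\<^sub>0 \<le> ?\<phi> y"
      by (simp add: inner_diff_left inner_diff_right)
    moreover have "?\<phi> x \<le> ?\<phi> x\<^sub>0" using min \<open>r \<ge> 0\<close> by simp
    ultimately show ?thesis by simp
  qed (rule min)
  then have "xs \<in> subdifferential \<psi> x"
    unfolding subdifferential_def by (auto simp: inner_diff_right algebra_simps)
  then show ?thesis by (rule that)
qed

text \<open>The subgradient inequality at x says exactly that x maximizes the expression under the
  supremum.\<close>

lemma fenchel_conjugate_at_subgradient:
  assumes "xs \<in> subdifferential \<psi> x"
  shows "fenchel_conjugate \<psi> xs = xs \<bullet> x - \<psi> x"
proof -
  have "xs \<bullet> y - \<psi> y \<le> xs \<bullet> x - \<psi> x" for y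
    using assms unfolding subdifferential_def by (auto simp: inner_diff_right algebra_simps)
  then show ?thesis
    unfolding fenchel_conjugate_def by (intro cSup_eq_maximum) auto
qed

lemma fenchel_young:
  assumes "xs \<in> subdifferential \<psi> x"
  shows "xs \<bullet> y - \<psi> y \<le> fenchel_conjugate \<psi> xs"
  using assms unfolding fenchel_conjugate_at_subgradient[OF assms] subdifferential_def
  by (auto simp: inner_diff_right algebra_simps)

text \<open>Fenchel-Young at \<open>xs + d\<close>, tested at the point x that attains the conjugate
  at xs.\<close>

lemma fenchel_conjugate_subgradient:
  fixes \<psi> :: "'a::euclidean_space \<Rightarrow> real"
  assumes sc: "strongly_convex \<mu> \<psi>" "\<mu> > 0" and sub: "xs \<in> subdifferential \<psi> x"
  shows "fenchel_conjugate \<psi> (xs + d) \<ge> fenchel_conjugate \<psi> xs + x \<bullet> d"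
proof -
  obtain y where y: "xs + d \<in> subdifferential \<psi> y"
    by (rule strongly_convex_subgradient_surj[OF sc sub])
  show ?thesis
    using fenchel_young[OF y, of x] fenchel_conjugate_at_subgradient[OF sub]
    by (simp add: inner_add_left inner_add_right inner_commute)
qed

text \<open>Let y attain the conjugate at \<open>xs + d\<close>. Strong convexity bounds
  \<open>\<psi> y\<close> from below through x, and Young's inequality with weight \<mu> absorbs the
  cross term \<open>d \<bullet> (y - x)\<close>.\<close>

lemma fenchel_conjugate_smooth:
  fixes \<psi> :: "'a::euclidean_space \<Rightarrow> real"
  assumes sc: "strongly_convex \<mu> \<psi>" "\<mu> > 0" and sub: "xs \<in> subdifferential \<psi> x"
  shows "fenchel_conjugate \<psi> (xs + d) \<le> fenchel_conjugate \<psi> xs + x \<bullet> d + (norm d)\<^sup>2 / (2 * \<mu>)"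
proof -
  obtain y where y: "xs + d \<in> subdifferential \<psi> y"
    by (rule strongly_convex_subgradient_surj[OF sc sub])
  have "0 \<le> (norm (d - \<mu> *\<^sub>R (y - x)))\<^sup>2 / (2 * \<mu>)" using sc(2) by simp
  also have "(norm (d - \<mu> *\<^sub>R (y - x)))\<^sup>2
      = (norm d)\<^sup>2 + \<mu>\<^sup>2 * (norm (y - x))\<^sup>2 - 2 * \<mu> * (d \<bullet> (y - x))"
    unfolding power2_norm_eq_inner
    by (simp add: algebra_simps inner_commute power2_eq_square)
  also have "\<dots> / (2 * \<mu>) = (norm d)\<^sup>2 / (2 * \<mu>) + \<mu> / 2 * (norm (y - x))\<^sup>2 - d \<bullet> (y - x)"
    using sc(2) by (simp add: field_simps power2_eq_square)
  finally have "d \<bullet> (y - x) \<le> (norm d)\<^sup>2 / (2 * \<mu>) + \<mu> / 2 * (norm (y - x))\<^sup>2" by simp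
  with strong_subgradient_inequality[OF sc(1) sub, of y] show ?thesis
    unfolding fenchel_conjugate_at_subgradient[OF sub] fenchel_conjugate_at_subgradient[OF y]
    by (simp add: inner_add_left inner_add_right inner_diff_right inner_commute)
qed

text \<open>The two preceding bounds squeeze the first-order remainder between 0 and
  \<open>(norm d)\<^sup>2 / (2 * \<mu>)\<close>, which gives differentiability and the gradient at
  once.\<close>

lemma grad_fenchel_conjugate:
  fixes \<psi> :: "'a::euclidean_space \<Rightarrow> real"
  assumes sc: "strongly_convex \<mu> \<psi>" "\<mu> > 0" and sub: "xs \<in> subdifferential \<psi> x"
  shows "grad (fenchel_conjugate \<psi>) xs = x"
proof (rule grad_eqI)
  let ?g = "fenchel_conjugate \<psi>"
  have "(?g has_derivative (\<lambda>h. h \<bullet> x)) (at xs)"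
    unfolding has_derivative_at
  proof
    show "((\<lambda>d. norm (?g (xs + d) - ?g xs - d \<bullet> x) / norm d) \<longlongrightarrow> 0) (at 0)"
    proof (rule tendsto_sandwich[of "\<lambda>_. 0"])
      show "((\<lambda>d::'a. norm d / (2 * \<mu>)) \<longlongrightarrow> 0) (at 0)"
        using sc(2) by (auto intro!: tendsto_eq_intros)
      have "norm (?g (xs + d) - ?g xs - d \<bullet> x) \<le> norm d / (2 * \<mu>) * norm d" for d
        using fenchel_conjugate_smooth[OF sc sub, of d] fenchel_conjugate_subgradient[OF sc sub, of d]
        by (simp add: inner_commute power2_eq_square)
      then show "\<forall>\<^sub>F d in at 0. norm (?g (xs + d) - ?g xs - d \<bullet> x) / norm d \<le> norm d / (2 * \<mu>)"
        by (auto simp: eventually_at_filter divide_le_eq)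
    qed auto
  qed (rule bounded_linear_inner_left)
  then show "GDERIV ?g xs :> x" unfolding gderiv_def .
qed

text \<open>Keeps the iteration in primal-dual pairs: after each update the dual vector is a
  subgradient at the new point.\<close>

lemma subdifferential_grad_conjugate:
  fixes \<psi> :: "'a::euclidean_space \<Rightarrow> real"
  assumes sc: "strongly_convex \<mu> \<psi>" "\<mu> > 0" and "xs\<^sub>0 \<in> subdifferential \<psi> x\<^sub>0"
  shows "xs \<in> subdifferential \<psi> (grad (fenchel_conjugate \<psi>) xs)"
  using strongly_convex_subgradient_surj[OF assms, of xs] grad_fenchel_conjugate[OF sc, of xs]
  by metis

section \<open>One step of the method\<close>

text \<open>Triangle inequality followed by Cauchy-Schwarz, that is, Jensen for the squared norm. It
  bounds both regularity quotients by 1.\<close>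

lemma norm_mean_le:
  fixes v :: "'b \<Rightarrow> 'a::real_normed_vector"
  assumes "finite S" "card S = n" "n > 0"
  shows "(norm (\<Sum>i\<in>S. (1 / real n) *\<^sub>R v i))\<^sup>2 \<le> (\<Sum>i\<in>S. 1 / real n * (norm (v i))\<^sup>2)"
proof -
  have "norm (\<Sum>i\<in>S. (1 / real n) *\<^sub>R v i) \<le> (\<Sum>i\<in>S. 1 / real n * norm (v i))"
    by (rule sum_norm_le) simp
  then have "(norm (\<Sum>i\<in>S. (1 / real n) *\<^sub>R v i))\<^sup>2 \<le> (\<Sum>i\<in>S. 1 / real n * norm (v i))\<^sup>2"
    by (rule power_mono) simp
  also have "\<dots> \<le> (\<Sum>i\<in>S. (1 / real n * norm (v i))\<^sup>2) * card S"
    using sum_squared_le_sum_of_squares assms(1) by blast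
  also have "\<dots> = (\<Sum>i\<in>S. 1 / real n * (norm (v i))\<^sup>2)"
    using assms by (simp add: sum_distrib_right power2_eq_square)
  finally show ?thesis .
qed

text \<open>The case \<open>b = 0\<close> uses \<open>a / 0 = 0\<close>, in line with the convention
  0 / 0 = 0 for the regularity quotients.\<close>

lemma divide_le_1_nonneg:
  fixes a b :: real
  assumes "a \<le> b" "0 \<le> b"
  shows "a / b \<le> 1"
  using assms by (cases "b = 0") (auto simp: divide_le_eq_1)

lemma block_ratio_le_1:
  assumes "finite S" "card S = \<tau>" "\<tau> > 0"
  shows "block_ratio f \<tau> S x \<le> 1"
proof -
  have "0 \<le> (\<Sum>i\<in>S. 1 / real \<tau> * (norm (grad (f i) x))\<^sup>2)" by (intro sum_nonneg) simp
  then show ?thesis unfolding block_ratio_def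
    using norm_mean_le[OF assms] by (intro divide_le_1_nonneg)
qed

lemma block_ratio_nonneg: "0 \<le> block_ratio f \<tau> S x"
  unfolding block_ratio_def by (intro divide_nonneg_nonneg sum_nonneg) auto

lemma smooth_regularity_bound:
  fixes f :: "nat \<Rightarrow> 'a::real_inner \<Rightarrow> real"
  assumes "m > 0"
  shows "(norm ((1 / real m) *\<^sub>R (\<Sum>i\<in>{1..m}. grad (f i) x)))\<^sup>2
      \<le> smooth_regularity m f * (1 / real m * (\<Sum>i\<in>{1..m}. (norm (grad (f i) x))\<^sup>2))"
    and "0 \<le> smooth_regularity m f"
proof -
  let ?n = "\<lambda>x. (norm ((1 / real m) *\<^sub>R (\<Sum>i\<in>{1..m}. grad (f i) x)))\<^sup>2"
  let ?d = "\<lambda>x. 1 / real m * (\<Sum>i\<in>{1..m}. (norm (grad (f i) x))\<^sup>2)"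
  have nd: "?n x \<le> ?d x" for x
    using norm_mean_le[of "{1..m}" m "\<lambda>i. grad (f i) x"] assms
    by (simp add: scaleR_sum_right sum_distrib_left)
  have d: "0 \<le> ?d x" for x by (intro mult_nonneg_nonneg sum_nonneg) auto
  have "?n x / ?d x \<le> 1" for x
    by (rule divide_le_1_nonneg[OF nd d])
  then have "bdd_above (range (\<lambda>x. ?n x / ?d x))" by (rule bdd_aboveI2)
  then have L: "?n x / ?d x \<le> smooth_regularity m f" for x
    unfolding smooth_regularity_def by (rule cSUP_upper[rotated]) simp
  show "?n x \<le> smooth_regularity m f * ?d x"
  \<comment> \<open>A zero denominator makes the quotient uninformative; Jensen then forces the
    numerator to vanish as well.\<close>
  proof (cases "?d x = 0")
    case True
    then show ?thesis using nd[of x] by (simp only: mult_zero_right)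
  next
    case False
    with d[of x] have "0 < ?d x" by (rule le_neq_trans[OF _ not_sym])
    with L[of x] show ?thesis using pos_divide_le_eq by blast
  qed
  have "0 \<le> ?n x / ?d x" using d by (intro divide_nonneg_nonneg) auto
  then show "0 \<le> smooth_regularity m f" using L[of x] by linarith
qed

text \<open>If \<open>xs\<close> is a subgradient at \<open>x\<close>, then \<open>\<psi> z + fenchel_conjugate \<psi> xs - xs \<bullet> z\<close> is the
  Bregman distance \<open>bregman \<psi> xs x z\<close>. The exact step minimizes an upper bound of it over all
  stepsizes, hence does at least as well as the adaptive one.\<close>

lemma sbbp_step_decrease:
  fixes \<psi> :: "'a::euclidean_space \<Rightarrow> real" and f :: "nat \<Rightarrow> 'a \<Rightarrow> real"
  defines "E \<equiv> \<lambda>z ys. \<psi> z + fenchel_conjugate \<psi> ys - ys \<bullet> z"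
  assumes sc: "strongly_convex \<mu> \<psi>" "\<mu> > 0" and sub: "xs \<in> subdifferential \<psi> x"
    and S: "finite S" and \<tau>: "\<tau> > 0"
    and conv: "\<And>i. i \<in> S \<Longrightarrow> convex_on UNIV (f i)"
    and diff: "\<And>i z. i \<in> S \<Longrightarrow> f i differentiable (at z)"
    and Lip: "\<And>i. i \<in> S \<Longrightarrow> 0 < Lip i" "\<And>i. i \<in> S \<Longrightarrow> Lip i \<le> Lmax"
    and lips: "\<And>i. i \<in> S \<Longrightarrow> lipschitz_on (Lip i) UNIV (grad (f i))"
    and nonneg: "\<And>i z. i \<in> S \<Longrightarrow> f i z \<ge> 0"
    and z: "\<And>i. i \<in> S \<Longrightarrow> f i z = 0"
    and B: "block_ratio f \<tau> S x \<le> B"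
    and step: "is_arg_min (\<lambda>s. fenchel_conjugate \<psi> (xs - s *\<^sub>R block_grad f \<tau> S x)
                   + s * block_offset f Lip \<tau> S x) (\<lambda>_. True) t \<or>
        ((\<exists>i\<in>S. grad (f i) x \<noteq> 0) \<longrightarrow> t = \<mu> / (Lmax * block_ratio f \<tau> S x))"
  shows "\<mu> * (\<Sum>i\<in>S. 1 / real \<tau> * (norm (grad (f i) x))\<^sup>2)
      \<le> 2 * Lmax\<^sup>2 * B * (E z xs - E z (xs - t *\<^sub>R block_grad f \<tau> S x))"
\<comment> \<open>If all sampled gradients vanish, both sides are 0 for every t.\<close>
proof (cases "\<forall>i\<in>S. grad (f i) x = 0")
  case True
  then show ?thesis by (simp add: block_grad_def)
next
  case False
  let ?\<alpha> = "block_grad f \<tau> S x"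
  let ?\<beta> = "block_offset f Lip \<tau> S x"
  let ?R = "block_ratio f \<tau> S x"
  let ?g = "fenchel_conjugate \<psi>"
  let ?q = "\<lambda>s. ?g (xs - s *\<^sub>R ?\<alpha>) + s * ?\<beta>"
  define G where "G = (\<Sum>i\<in>S. 1 / real \<tau> * (norm (grad (f i) x))\<^sup>2)"
  define P where "P = (\<Sum>i\<in>S. (1 / real \<tau>) / Lip i * (norm (grad (f i) x))\<^sup>2)"
  obtain j where j: "j \<in> S" "grad (f j) x \<noteq> 0" using False by blast
  have Lmax: "0 < Lmax" using Lip[OF j(1)] by linarith
  have "G > 0" unfolding G_def
    using j \<tau> by (intro sum_pos2[OF S j(1)]) auto
  have "G / Lmax \<le> P"
    unfolding G_def P_def sum_divide_distrib
  proof (rule sum_mono)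
    fix i assume i: "i \<in> S"
    have "1 / Lmax \<le> 1 / Lip i" using Lip[OF i] by (simp add: frac_le)
    then have "1 / real \<tau> * (norm (grad (f i) x))\<^sup>2 * (1 / Lmax)
        \<le> 1 / real \<tau> * (norm (grad (f i) x))\<^sup>2 * (1 / Lip i)"
      by (rule mult_left_mono) simp
    then show "1 / real \<tau> * (norm (grad (f i) x))\<^sup>2 / Lmax
        \<le> 1 / real \<tau> / Lip i * (norm (grad (f i) x))\<^sup>2"
      by (simp add: mult_ac)
  qed
  with \<open>G > 0\<close> Lmax have "P > 0" by (meson divide_pos_pos less_le_trans)
  \<comment> \<open>Averaged cocoercivity. Since \<open>?\<beta>\<close> equals
    \<open>?\<alpha> \<bullet> x - P\<close>, it says
    \<open>?\<alpha> \<bullet> z \<le> ?\<beta>\<close>: z lies in a half-space that x violates by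
    P.\<close>
  have P: "P \<le> ?\<alpha> \<bullet> (x - z)"
    unfolding P_def block_grad_def inner_sum_left
  proof (rule sum_mono)
    fix i assume i: "i \<in> S"
    have "(norm (grad (f i) x))\<^sup>2 / Lip i \<le> grad (f i) x \<bullet> (x - z)"
      using i by (intro cocoercive_at_zero conv diff lips Lip nonneg z)
    then have "1 / real \<tau> * ((norm (grad (f i) x))\<^sup>2 / Lip i)
        \<le> 1 / real \<tau> * (grad (f i) x \<bullet> (x - z))"
      by (rule mult_left_mono) simp
    then show "1 / real \<tau> / Lip i * (norm (grad (f i) x))\<^sup>2
        \<le> ((1 / real \<tau>) *\<^sub>R grad (f i) x) \<bullet> (x - z)"
      by simp
  qed
  have \<beta>: "?\<beta> = ?\<alpha> \<bullet> x - P" by (simp add: block_offset_def P_def)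
  have "?\<alpha> \<noteq> 0" using P \<open>P > 0\<close> by auto
  have R: "?R = (norm ?\<alpha>)\<^sup>2 / G"
    by (simp add: block_ratio_def block_grad_def G_def)
  have "?R > 0" using R \<open>?\<alpha> \<noteq> 0\<close> \<open>G > 0\<close> by simp
  \<comment> \<open>The adaptive stepsize; it minimizes the quadratic
    \<open>- s * (G / Lmax) + s\<^sup>2 * (?R * G) / (2 * \<mu>)\<close> that appears in the bound
    below.\<close>
  define s where "s = \<mu> / (Lmax * ?R)"
  have "s > 0" using \<open>\<mu> > 0\<close> Lmax \<open>?R > 0\<close> by (simp add: s_def)
  have "?q s \<le> ?g xs - s * P + (norm (s *\<^sub>R ?\<alpha>))\<^sup>2 / (2 * \<mu>)"
    using fenchel_conjugate_smooth[OF sc sub, of "- s *\<^sub>R ?\<alpha>"] unfolding \<beta>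
    by (simp add: algebra_simps inner_commute)
  also have "\<dots> \<le> ?g xs - s * (G / Lmax) + s\<^sup>2 * (?R * G) / (2 * \<mu>)"
  proof -
    have "s * (G / Lmax) \<le> s * P"
      using \<open>G / Lmax \<le> P\<close> \<open>s > 0\<close> by (intro mult_left_mono) auto
    moreover have "?R * G = (norm ?\<alpha>)\<^sup>2" using R \<open>G > 0\<close> by simp
    ultimately show ?thesis by (simp add: power_mult_distrib)
  qed
  also have "\<dots> = ?g xs - \<mu> * G / (2 * Lmax\<^sup>2 * ?R)"
    using \<open>\<mu> > 0\<close> Lmax \<open>?R > 0\<close> by (simp add: s_def field_simps power2_eq_square)
  finally have qs: "?q s \<le> ?g xs - \<mu> * G / (2 * Lmax\<^sup>2 * ?R)" .
  \<comment> \<open>The sign matters because an inequality is multiplied by t afterwards. For the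
    exact rule it follows from \<open>?q t \<le> ?q 0\<close> together with the linear lower bound
    on \<open>?q\<close>.\<close>
  have "0 \<le> t \<and> ?q t \<le> ?q s"
    using step
  proof
    assume "is_arg_min ?q (\<lambda>_. True) t"
    then have min: "?q t \<le> ?q r" for r by (auto simp: is_arg_min_linorder)
    have "?g xs - t * P \<le> ?q t"
      using fenchel_conjugate_subgradient[OF sc sub, of "- t *\<^sub>R ?\<alpha>"] unfolding \<beta>
      by (simp add: algebra_simps inner_commute)
    also have "\<dots> \<le> ?g xs" using min[of 0] by simp
    finally have "0 \<le> t" using \<open>P > 0\<close> by (simp add: zero_le_mult_iff)
    with min show ?thesis by blast
  next
    assume "(\<exists>i\<in>S. grad (f i) x \<noteq> 0) \<longrightarrow> t = \<mu> / (Lmax * ?R)"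
    then have "t = s" using False by (simp add: s_def)
    with \<open>s > 0\<close> show ?thesis by simp
  qed
  then have "0 \<le> t" "?q t \<le> ?q s" by auto
  \<comment> \<open>Trades the term in the unknown z for the computable offset, so that
    \<open>?q t\<close> controls the next Bregman distance.\<close>
  have "t * P \<le> t * (?\<alpha> \<bullet> (x - z))" using P \<open>0 \<le> t\<close> by (rule mult_left_mono)
  then have "E z (xs - t *\<^sub>R ?\<alpha>) \<le> \<psi> z - xs \<bullet> z + ?q t"
    unfolding E_def \<beta> by (simp add: algebra_simps inner_diff_left inner_diff_right)
  also have "\<dots> \<le> E z xs - \<mu> * G / (2 * Lmax\<^sup>2 * ?R)"
    using qs \<open>?q t \<le> ?q s\<close> unfolding E_def by simp
  finally have dec: "\<mu> * G / (2 * Lmax\<^sup>2 * ?R) \<le> E z xs - E z (xs - t *\<^sub>R ?\<alpha>)" (is "_ \<le> ?\<Delta>") by simp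
  \<comment> \<open>Only a nonnegative decrease allows \<open>?R\<close> to be enlarged to
    B.\<close>
  have "0 \<le> \<mu> * G / (2 * Lmax\<^sup>2 * ?R)" using \<open>\<mu> > 0\<close> \<open>G > 0\<close> \<open>?R > 0\<close> by simp
  with dec have "0 \<le> ?\<Delta>" by linarith
  have "\<mu> * G \<le> 2 * Lmax\<^sup>2 * ?R * ?\<Delta>"
    using dec Lmax \<open>?R > 0\<close> by (simp add: divide_le_eq mult_ac)
  also have "\<dots> \<le> 2 * Lmax\<^sup>2 * B * ?\<Delta>"
    using B \<open>0 \<le> ?\<Delta>\<close> by (intro mult_right_mono mult_left_mono) auto
  finally show ?thesis unfolding G_def .
qed

section \<open>Block sampling\<close>

text \<open>A random variable determined by finitely many sampled blocks takes finitely many values,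
  so every function of it is integrable.\<close>

lemma (in prob_space)
  fixes h :: "nat \<Rightarrow> 'b \<Rightarrow> real"
  assumes samp: "block_sampling M m \<tau> J" and "\<tau> > 0"
    and hist: "\<And>\<omega> \<omega>'. \<omega> \<in> space M \<Longrightarrow> \<omega>' \<in> space M \<Longrightarrow> (\<forall>j<k. J j \<omega> = J j \<omega>') \<Longrightarrow> y \<omega> = y \<omega>'"
  shows integrable_of_history: "integrable M (\<lambda>\<omega>. g (y \<omega>) :: real)"
    and integrable_block_mean: "integrable M (\<lambda>\<omega>. \<Sum>i\<in>J k \<omega>. 1 / real \<tau> * h i (y \<omega>))"
    and expectation_block_mean:
      "expectation (\<lambda>\<omega>. \<Sum>i\<in>J k \<omega>. 1 / real \<tau> * h i (y \<omega>))
       = expectation (\<lambda>\<omega>. 1 / real m * (\<Sum>i\<in>{1..m}. h i (y \<omega>)))"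
proof -
  let ?N = "\<lambda>_::nat. count_space (Pow {1..m})"
  let ?P = "{..<k} \<rightarrow>\<^sub>E Pow {1..m}"
  define H where "H \<omega> = (\<lambda>j\<in>{..<k}. J j \<omega>)" for \<omega>
  \<comment> \<open>Recovers y from the history: evaluate it at any outcome with that history, a
    choice that \<open>hist\<close> makes immaterial.\<close>
  define \<Phi> where "\<Phi> p = y (SOME \<omega>. \<omega> \<in> space M \<and> H \<omega> = p)" for p
  have ind: "indep_vars ?N J UNIV"
    using samp by (simp add: block_sampling_def)
  have J: "J j \<omega> \<subseteq> {1..m}" if "\<omega> \<in> space M" for j \<omega>
    using ind that measurable_space[of "J j" M "?N j" \<omega>] by (simp add: indep_vars_def)
  have y: "y \<omega> = \<Phi> (H \<omega>)" if "\<omega> \<in> space M" for \<omega>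
  proof -
    have "\<exists>\<omega>'. \<omega>' \<in> space M \<and> H \<omega>' = H \<omega>" using that by blast
    then obtain \<omega>' where \<omega>': "\<omega>' \<in> space M" "H \<omega>' = H \<omega>" and \<Phi>: "\<Phi> (H \<omega>) = y \<omega>'"
      unfolding \<Phi>_def by (metis (mono_tags, lifting) someI_ex)
    have "J j \<omega> = J j \<omega>'" if "j < k" for j
      using fun_cong[OF \<omega>'(2), of j] that by (simp add: H_def)
    then show ?thesis using hist[OF that \<omega>'(1)] \<Phi> by simp
  qed
  \<comment> \<open>Finitely many blocks with finitely many values: the product sigma-algebra is
    discrete, so every function of H is measurable.\<close>
  have PiM: "PiM {..<k} ?N = count_space ?P"
    by (intro count_space_PiM_finite) (auto intro: countable_finite)
  \<comment> \<open>Disjoint index sets separate the current draw from the past, and hence from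
    y.\<close>
  have indk: "indep_var (PiM {k} ?N) (\<lambda>\<omega>. \<lambda>j\<in>{k}. J j \<omega>) (PiM {..<k} ?N) H"
    unfolding H_def by (intro indep_var_restrict[OF ind]) auto
  have H: "H \<in> measurable M (count_space ?P)"
    using indep_var_rv2[OF indk] PiM by simp
  have "finite ?P" by (intro finite_PiE) auto
  have int: "integrable M (\<lambda>\<omega>. g (y \<omega>))" for g :: "'b \<Rightarrow> real"
  proof -
    have "(\<lambda>\<omega>. g (\<Phi> (H \<omega>))) \<in> borel_measurable M"
      by (rule measurable_compose[OF H]) simp
    moreover have "AE \<omega> in M. norm (g (\<Phi> (H \<omega>))) \<le> Max ((\<lambda>p. \<bar>g (\<Phi> p)\<bar>) ` ?P)"
      using measurable_space[OF H] \<open>finite ?P\<close> by (intro AE_I2) auto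
    ultimately have "integrable M (\<lambda>\<omega>. g (\<Phi> (H \<omega>)))"
      by (intro integrable_const_bound)
    then show ?thesis using y by (simp cong: Bochner_Integration.integrable_cong)
  qed
  then show "integrable M (\<lambda>\<omega>. g (y \<omega>))" .

  let ?I = "\<lambda>i \<omega>. indicator {S. i \<in> S} (J k \<omega>) :: real"
  have I: "integrable M (\<lambda>\<omega>. ?I i \<omega> * h i (y \<omega>)) \<and>
      expectation (\<lambda>\<omega>. ?I i \<omega> * h i (y \<omega>)) = real \<tau> / real m * expectation (\<lambda>\<omega>. h i (y \<omega>))"
    if "i \<in> {1..m}" for i
  proof -
    have "indep_var borel ((\<lambda>p. indicator {S. i \<in> S} (p k) :: real) \<circ> (\<lambda>\<omega>. \<lambda>j\<in>{k}. J j \<omega>))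
        borel ((\<lambda>p. h i (\<Phi> p)) \<circ> H)"
    proof (rule indep_var_compose[OF indk])
      have "(\<lambda>p. p k) \<in> measurable (PiM {k} ?N) (count_space (Pow {1..m}))"
        by (rule measurable_component_singleton) simp
      then show "(\<lambda>p. indicator {S. i \<in> S} (p k) :: real) \<in> borel_measurable (PiM {k} ?N)"
        by (rule measurable_compose) simp
      show "(\<lambda>p. h i (\<Phi> p)) \<in> borel_measurable (PiM {..<k} ?N)"
        unfolding PiM by simp
    qed
    then have iv: "indep_var borel (?I i) borel (\<lambda>\<omega>. h i (\<Phi> (H \<omega>)))"
      by (simp add: comp_def)
    have Jk: "J k \<in> measurable M (count_space (Pow {1..m}))"
      using ind by (simp add: indep_vars_def)
    have ev: "{\<omega> \<in> space M. i \<in> J k \<omega>} \<in> events"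
    proof -
      have "J k -` {S \<in> Pow {1..m}. i \<in> S} \<inter> space M \<in> events"
        by (rule measurable_sets[OF Jk]) auto
      also have "J k -` {S \<in> Pow {1..m}. i \<in> S} \<inter> space M = {\<omega> \<in> space M. i \<in> J k \<omega>}"
        using J by blast
      finally show ?thesis .
    qed
    have intI: "integrable M (?I i)"
      using indep_var_rv1[OF iv] by (intro integrable_const_bound[of _ 1]) (auto simp: indicator_def)
    have inth: "integrable M (\<lambda>\<omega>. h i (\<Phi> (H \<omega>)))"
      using int[of "h i"] y by (simp cong: Bochner_Integration.integrable_cong)
    have "expectation (?I i) = expectation (indicator {\<omega> \<in> space M. i \<in> J k \<omega>})"
      by (intro Bochner_Integration.integral_cong) (auto simp: indicator_def)
    also have "\<dots> = prob {\<omega> \<in> space M. i \<in> J k \<omega>}" using ev by simp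
    also have "\<dots> = real \<tau> / real m" using samp that by (simp add: block_sampling_def)
    finally have "expectation (\<lambda>\<omega>. ?I i \<omega> * h i (\<Phi> (H \<omega>)))
        = real \<tau> / real m * expectation (\<lambda>\<omega>. h i (\<Phi> (H \<omega>)))"
      using indep_var_lebesgue_integral[OF iv intI inth] by simp
    with indep_var_integrable[OF iv intI inth] show ?thesis
      using y by (simp cong: Bochner_Integration.integral_cong Bochner_Integration.integrable_cong)
  qed
  \<comment> \<open>Membership indicators turn the sum over a random index set into one over
    \<open>{1..m}\<close>, so that the expectation can pass inside.\<close>
  have sum: "(\<Sum>i\<in>J k \<omega>. 1 / real \<tau> * h i (y \<omega>))
      = (\<Sum>i\<in>{1..m}. 1 / real \<tau> * (?I i \<omega> * h i (y \<omega>)))" if "\<omega> \<in> space M" for \<omega>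
    using J[OF that] by (intro sum.mono_neutral_cong_left) (auto simp: indicator_def)
  have "integrable M (\<lambda>\<omega>. \<Sum>i\<in>{1..m}. 1 / real \<tau> * (?I i \<omega> * h i (y \<omega>)))"
    using I by (intro Bochner_Integration.integrable_sum integrable_mult_right) auto
  then show "integrable M (\<lambda>\<omega>. \<Sum>i\<in>J k \<omega>. 1 / real \<tau> * h i (y \<omega>))"
    using sum by (simp cong: Bochner_Integration.integrable_cong)
  have "expectation (\<lambda>\<omega>. \<Sum>i\<in>J k \<omega>. 1 / real \<tau> * h i (y \<omega>))
      = expectation (\<lambda>\<omega>. \<Sum>i\<in>{1..m}. 1 / real \<tau> * (?I i \<omega> * h i (y \<omega>)))"
    using sum by (intro Bochner_Integration.integral_cong) auto
  also have "\<dots> = (\<Sum>i\<in>{1..m}. 1 / real \<tau> * expectation (\<lambda>\<omega>. ?I i \<omega> * h i (y \<omega>)))"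
  proof (subst Bochner_Integration.integral_sum)
    show "integrable M (\<lambda>\<omega>. 1 / real \<tau> * (?I i \<omega> * h i (y \<omega>)))" if "i \<in> {1..m}" for i
      using I[OF that] by (intro integrable_mult_right) blast
  qed (simp only: integral_mult_right_zero)
  also have "\<dots> = (\<Sum>i\<in>{1..m}. 1 / real m * expectation (\<lambda>\<omega>. h i (y \<omega>)))"
  \<comment> \<open>The inclusion probability \<tau> / m meets the weight 1 / \<tau>, leaving the
    uniform weight 1 / m.\<close>
  proof (rule sum.cong[OF refl])
    fix i assume "i \<in> {1..m}"
    from I[OF this] \<open>\<tau> > 0\<close>
    show "1 / real \<tau> * expectation (\<lambda>\<omega>. ?I i \<omega> * h i (y \<omega>))
        = 1 / real m * expectation (\<lambda>\<omega>. h i (y \<omega>))" by simp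
  qed
  also have "\<dots> = expectation (\<lambda>\<omega>. 1 / real m * (\<Sum>i\<in>{1..m}. h i (y \<omega>)))"
    using int by (simp add: sum_distrib_left)
  finally show "expectation (\<lambda>\<omega>. \<Sum>i\<in>J k \<omega>. 1 / real \<tau> * h i (y \<omega>))
       = expectation (\<lambda>\<omega>. 1 / real m * (\<Sum>i\<in>{1..m}. h i (y \<omega>)))" .
qed

text \<open>Provides the dependence on past blocks that makes the iterate independent of the next
  draw. The adaptive stepsize is a function of the current iterate and block; for the exact rule,
  the non-anticipation clause fixes the choice of minimizer.\<close>

lemma sbbp_determined_by_history:
  assumes sbbp: "sbbp M \<psi> f \<tau> J t x\<^sub>0 xs\<^sub>0 x xs"
    and step: "exact_stepsize M \<psi> f Lip \<tau> J x xs t \<or> adaptive_stepsize M \<mu> f Lmax \<tau> J x t"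
    and \<omega>: "\<omega> \<in> space M" "\<omega>' \<in> space M"
  shows "\<forall>j<k. J j \<omega> = J j \<omega>' \<Longrightarrow> x k \<omega> = x k \<omega>' \<and> xs k \<omega> = xs k \<omega>'"
proof (induction k)
  case 0
  then show ?case using sbbp \<omega> by (simp add: sbbp_def)
next
  case (Suc k)
  then have IH: "x k \<omega> = x k \<omega>'" "xs k \<omega> = xs k \<omega>'" and J: "\<forall>j\<le>k. J j \<omega> = J j \<omega>'" by auto
  have "t k \<omega> *\<^sub>R block_grad f \<tau> (J k \<omega>) (x k \<omega>) = t k \<omega>' *\<^sub>R block_grad f \<tau> (J k \<omega>') (x k \<omega>')"
  proof (cases "\<exists>i\<in>J k \<omega>. grad (f i) (x k \<omega>) \<noteq> 0")
    case True
    from step have "t k \<omega> = t k \<omega>'"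
    proof
      assume "exact_stepsize M \<psi> f Lip \<tau> J x xs t"
      then show ?thesis using \<omega> J unfolding exact_stepsize_def by blast
    next
      assume adaptive: "adaptive_stepsize M \<mu> f Lmax \<tau> J x t"
      have "\<exists>i\<in>J k \<omega>'. grad (f i) (x k \<omega>') \<noteq> 0" using True J IH by simp
      with adaptive \<omega> True
      have "t k \<omega> = \<mu> / (Lmax * block_ratio f \<tau> (J k \<omega>) (x k \<omega>))"
        "t k \<omega>' = \<mu> / (Lmax * block_ratio f \<tau> (J k \<omega>') (x k \<omega>'))"
        unfolding adaptive_stepsize_def by blast+
      then show ?thesis using J IH by simp
    qed
    then show ?thesis using J IH by simp
  next
    \<comment> \<open>The stepsizes at the two outcomes may differ here, but they multiply a zero
      direction.\<close>
    case False
    then show ?thesis using J IH by (simp add: block_grad_def)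
  qed
  then show ?case using sbbp \<omega> IH by (simp add: sbbp_def)
qed

section \<open>Convergence rates in expectation\<close>

theorem theorem4:
  fixes M :: "'w measure"
    and m \<tau> :: nat
    and C :: "nat \<Rightarrow> (real ^ 'n) set"
    and f :: "nat \<Rightarrow> real ^ 'n \<Rightarrow> real"
    and Lip :: "nat \<Rightarrow> real"
    and \<psi> :: "real ^ 'n \<Rightarrow> real"
    and \<mu> :: real
    and J :: "nat \<Rightarrow> 'w \<Rightarrow> nat set"
    and t :: "nat \<Rightarrow> 'w \<Rightarrow> real"
    and x\<^sub>0 xs\<^sub>0 :: "real ^ 'n"
    and x xs :: "nat \<Rightarrow> 'w \<Rightarrow> real ^ 'n"
  defines "F \<equiv> avg_fun m f"
    and "Fbar \<equiv> (INF z. avg_fun m f z)"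
    and "Xbar \<equiv> argmin_set (avg_fun m f)"
    and "Lmax \<equiv> Max (Lip ` {1..m})"
    and "L \<equiv> smooth_regularity m f"
    and "Lblock \<equiv> block_regularity M f \<tau> J x"
  assumes "prob_space M"
    and "1 \<le> \<tau>" "\<tau> \<le> m"
    and "\<And>i. i \<in> {1..m} \<Longrightarrow> closed (C i)"
    and "\<And>i. i \<in> {1..m} \<Longrightarrow> convex (C i)"
    and "(\<Inter>i\<in>{1..m}. C i) \<noteq> {}"
    and "\<mu> > 0" "strongly_convex \<mu> \<psi>"
    and "\<And>i. i \<in> {1..m} \<Longrightarrow> convex_on UNIV (f i)"
    and "\<And>i z. i \<in> {1..m} \<Longrightarrow> f i differentiable (at z)"
    and "\<And>i. i \<in> {1..m} \<Longrightarrow> Lip i > 0"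
    and "\<And>i. i \<in> {1..m} \<Longrightarrow> lipschitz_on (Lip i) UNIV (grad (f i))"
    and "\<And>i z. i \<in> {1..m} \<Longrightarrow> f i z \<ge> 0"
    and "\<And>i z. i \<in> {1..m} \<Longrightarrow> f i z = 0 \<longleftrightarrow> z \<in> C i"
    and "block_sampling M m \<tau> J"
    and "sbbp M \<psi> f \<tau> J t x\<^sub>0 xs\<^sub>0 x xs"
    and "exact_stepsize M \<psi> f Lip \<tau> J x xs t \<or> adaptive_stepsize M \<mu> f Lmax \<tau> J x t"
  shows "(\<forall>K\<ge>1. Min ((\<lambda>k. prob_space.expectation M (\<lambda>\<omega>. (norm (grad F (x k \<omega>)))\<^sup>2)) ` {0..K - 1})
            \<le> 2 * L * Lmax\<^sup>2 * Lblock / (\<mu> * real K) * bregman_dist_sq \<psi> xs\<^sub>0 x\<^sub>0 Xbar)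
       \<and> (\<forall>\<gamma>>0. (\<forall>z. sqrt (\<gamma> * \<mu> / 2) * sqrt (F z - Fbar) \<le> norm (grad F z)) \<longrightarrow>
            (\<forall>K\<ge>1. prob_space.expectation M
                       (\<lambda>\<omega>. F ((1 / real K) *\<^sub>R (\<Sum>k = 0..K - 1. x k \<omega>)) - Fbar)
               \<le> 4 * L * Lmax\<^sup>2 * Lblock / (\<mu>\<^sup>2 * \<gamma> * real K) * bregman_dist_sq \<psi> xs\<^sub>0 x\<^sub>0 Xbar))"
proof -
  interpret prob_space M by fact
  note conv = assms(15) and diff = assms(16) and Lip_pos = assms(17) and lips = assms(18)
    and nonneg = assms(19) and zero_iff = assms(20) and samp = assms(21) and sbbp = assms(22)
    and step = assms(23) and sc = assms(14,13)
  have "\<tau> > 0" "m > 0" using assms(8,9) by auto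
  have sub\<^sub>0: "xs\<^sub>0 \<in> subdifferential \<psi> x\<^sub>0"
    and x0: "\<And>\<omega>. \<omega> \<in> space M \<Longrightarrow> x 0 \<omega> = x\<^sub>0 \<and> xs 0 \<omega> = xs\<^sub>0"
    and upd: "\<And>k \<omega>. \<omega> \<in> space M \<Longrightarrow>
        xs (Suc k) \<omega> = xs k \<omega> - t k \<omega> *\<^sub>R block_grad f \<tau> (J k \<omega>) (x k \<omega>) \<and>
        x (Suc k) \<omega> = grad (fenchel_conjugate \<psi>) (xs (Suc k) \<omega>)"
    using sbbp by (auto simp: sbbp_def)
  have sub: "xs k \<omega> \<in> subdifferential \<psi> (x k \<omega>)" if "\<omega> \<in> space M" for k \<omega>
    using that x0 sub\<^sub>0 upd subdifferential_grad_conjugate[OF sc sub\<^sub>0] by (cases k) auto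
  have J: "J k \<omega> \<subseteq> {1..m}" "finite (J k \<omega>)" "card (J k \<omega>) = \<tau>" if "\<omega> \<in> space M" for k \<omega>
  proof -
    have "J k \<in> measurable M (count_space (Pow {1..m}))"
      using samp by (simp add: block_sampling_def indep_vars_def)
    from measurable_space[OF this that] show "J k \<omega> \<subseteq> {1..m}" by simp
    then show "finite (J k \<omega>)" by (rule finite_subset) simp
    show "card (J k \<omega>) = \<tau>" using samp that by (simp add: block_sampling_def)
  qed
  have hist: "x k \<omega> = x k \<omega>'"
    if "\<omega> \<in> space M" "\<omega>' \<in> space M" "\<forall>j<k. J j \<omega> = J j \<omega>'" for k \<omega> \<omega>'
    using sbbp_determined_by_history[OF sbbp step that] by simp

  have Lblock: "block_ratio f \<tau> (J k \<omega>) (x k \<omega>) \<le> Lblock" if "\<omega> \<in> space M" for k \<omega>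
  proof -
    let ?r = "\<lambda>(k, \<omega>). block_ratio f \<tau> (J k \<omega>) (x k \<omega>)"
    have "bdd_above (?r ` (UNIV \<times> space M))"
      by (intro bdd_aboveI2[where M = 1]) (auto intro!: block_ratio_le_1[OF J(2,3) \<open>\<tau> > 0\<close>])
    then have "?r (k, \<omega>) \<le> (SUP p\<in>UNIV \<times> space M. ?r p)"
      using that by (intro cSUP_upper) auto
    then show ?thesis unfolding Lblock_def block_regularity_def by simp
  qed
  obtain \<omega>\<^sub>0 where "\<omega>\<^sub>0 \<in> space M" using not_empty by blast
  then have "0 \<le> Lblock"
    using Lblock block_ratio_nonneg order_trans by blast
  have "0 \<le> L" using smooth_regularity_bound(2)[OF \<open>m > 0\<close>] unfolding L_def .
  have Lmax: "Lip i \<le> Lmax" if "i \<in> {1..m}" for i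
    using that unfolding Lmax_def by (intro Max_ge) auto

  \<comment> \<open>Common zeros and minimizers of the average\<close>
  have F_nonneg: "0 \<le> F z" for z
    unfolding F_def avg_fun_def by (intro mult_nonneg_nonneg sum_nonneg nonneg) auto
  obtain c where c: "c \<in> (\<Inter>i\<in>{1..m}. C i)" using assms(12) by blast
  have "f i c = 0" if "i \<in> {1..m}" for i using zero_iff[OF that] c that by blast
  then have "F c = 0" by (simp add: F_def avg_fun_def)
  have "Fbar = F c"
    unfolding Fbar_def using F_nonneg \<open>F c = 0\<close> unfolding F_def
    by (intro cInf_eq_minimum) auto
  with \<open>F c = 0\<close> have "Fbar = 0" by simp
  have "c \<in> Xbar"
    using F_nonneg \<open>F c = 0\<close> unfolding Xbar_def argmin_set_def F_def
    by (auto simp: is_arg_min_linorder)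
  \<comment> \<open>A minimizer has the value \<open>F c = 0\<close>, and a zero sum of nonnegative
    terms vanishes termwise; so every point of Xbar can serve as z in the one-step estimate.\<close>
  have Xbar: "f i z = 0" if "z \<in> Xbar" "i \<in> {1..m}" for z i
  proof -
    have "F z \<le> F c"
      using that(1) unfolding Xbar_def argmin_set_def F_def by (auto simp: is_arg_min_linorder)
    with F_nonneg[of z] \<open>F c = 0\<close> have "F z = 0" by simp
    then have "(\<Sum>i\<in>{1..m}. f i z) = 0" using \<open>m > 0\<close> by (simp add: F_def avg_fun_def)
    then show ?thesis using that(2) nonneg by (subst (asm) sum_nonneg_eq_0_iff) auto
  qed

  \<comment> \<open>Summed gradient bounds along the iteration\<close>
  define G where "G k \<omega> = (\<Sum>i\<in>J k \<omega>. 1 / real \<tau> * (norm (grad (f i) (x k \<omega>)))\<^sup>2)" for k \<omega>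
  define Q where "Q y = 1 / real m * (\<Sum>i\<in>{1..m}. (norm (grad (f i) y))\<^sup>2)" for y
  define A where "A k = expectation (\<lambda>\<omega>. (norm (grad F (x k \<omega>)))\<^sup>2)" for k
  define W where "W = bregman_dist_sq \<psi> xs\<^sub>0 x\<^sub>0 Xbar"
  have int: "integrable M (\<lambda>\<omega>. g (x k \<omega>))" for k and g :: "real ^ 'n \<Rightarrow> real"
    by (rule integrable_of_history[OF samp \<open>\<tau> > 0\<close>]) (rule hist)
  have intG: "integrable M (G k)" for k
    unfolding G_def[abs_def] by (rule integrable_block_mean[OF samp \<open>\<tau> > 0\<close>]) (rule hist)
  have EG: "expectation (G k) = expectation (\<lambda>\<omega>. Q (x k \<omega>))" for k
    unfolding G_def[abs_def] Q_def by (rule expectation_block_mean[OF samp \<open>\<tau> > 0\<close>]) (rule hist)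

  have sum_G: "\<mu> * (\<Sum>k<K. G k \<omega>) \<le> 2 * Lmax\<^sup>2 * Lblock * bregman \<psi> xs\<^sub>0 x\<^sub>0 z"
    if "\<omega> \<in> space M" "z \<in> Xbar" for K \<omega> z
  proof -
    \<comment> \<open>By Fenchel-Young with equality, \<open>?E k\<close> is the Bregman distance
      from the k-th iterate to z; its decreases telescope on every sample path.\<close>
    let ?E = "\<lambda>k. \<psi> z + fenchel_conjugate \<psi> (xs k \<omega>) - xs k \<omega> \<bullet> z"
    have "\<mu> * G k \<omega> \<le> 2 * Lmax\<^sup>2 * Lblock * (?E k - ?E (Suc k))" for k
    proof -
      have sp: "is_arg_min (\<lambda>s. fenchel_conjugate \<psi> (xs k \<omega> - s *\<^sub>R block_grad f \<tau> (J k \<omega>) (x k \<omega>))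
              + s * block_offset f Lip \<tau> (J k \<omega>) (x k \<omega>)) (\<lambda>_. True) (t k \<omega>) \<or>
          ((\<exists>i\<in>J k \<omega>. grad (f i) (x k \<omega>) \<noteq> 0) \<longrightarrow>
             t k \<omega> = \<mu> / (Lmax * block_ratio f \<tau> (J k \<omega>) (x k \<omega>)))"
        using step that(1) unfolding exact_stepsize_def adaptive_stepsize_def by blast
      have i: "i \<in> {1..m}" if "i \<in> J k \<omega>" for i
        using J(1)[OF \<open>\<omega> \<in> space M\<close>] that by blast
      show ?thesis
        unfolding G_def upd[OF that(1), THEN conjunct1]
        using sbbp_step_decrease[where Lip = Lip, OF sc sub[OF that(1)] J(2)[OF that(1)] \<open>\<tau> > 0\<close>
            conv[OF i] diff[OF i] Lip_pos[OF i] Lmax[OF i] lips[OF i] nonneg[OF i]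
            Xbar[OF that(2) i] Lblock[OF that(1)] sp] .
    qed
    then have "(\<Sum>k<K. \<mu> * G k \<omega>) \<le> (\<Sum>k<K. 2 * Lmax\<^sup>2 * Lblock * (?E k - ?E (Suc k)))"
      by (intro sum_mono) auto
    also have "\<dots> = 2 * Lmax\<^sup>2 * Lblock * (?E 0 - ?E K)"
      by (simp only: sum_distrib_left[symmetric] sum_lessThan_telescope'[of ?E])
    also have "\<dots> \<le> 2 * Lmax\<^sup>2 * Lblock * ?E 0"
      using fenchel_young[OF sub[OF that(1)], of K z] \<open>0 \<le> Lblock\<close>
      by (intro mult_left_mono) auto
    also have "?E 0 = bregman \<psi> xs\<^sub>0 x\<^sub>0 z"
      using x0[OF that(1)] fenchel_conjugate_at_subgradient[OF sub\<^sub>0]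
      by (simp add: bregman_def inner_diff_right)
    finally show ?thesis by (simp add: sum_distrib_left)
  qed

  \<comment> \<open>Pointwise, L trades the squared norm of the gradient of F for the mean
    \<open>Q\<close> over all indices; \<open>EG\<close> then replaces that mean by the sampled
    one.\<close>
  have A_le: "A k \<le> L * expectation (G k)" for k
  proof -
    have "A k \<le> expectation (\<lambda>\<omega>. L * Q (x k \<omega>))"
      unfolding A_def
    proof (rule integral_mono)
      fix \<omega>
      have "grad F (x k \<omega>) = (1 / real m) *\<^sub>R (\<Sum>i\<in>{1..m}. grad (f i) (x k \<omega>))"
        unfolding F_def by (rule grad_avg_fun) (rule diff)
      then show "(norm (grad F (x k \<omega>)))\<^sup>2 \<le> L * Q (x k \<omega>)"
        using smooth_regularity_bound(1)[OF \<open>m > 0\<close>] unfolding L_def Q_def by simp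
    qed (rule int)+
    then show ?thesis using EG by simp
  qed
  have A_sum_bregman: "(\<Sum>k<K. A k) \<le> 2 * L * Lmax\<^sup>2 * Lblock / \<mu> * bregman \<psi> xs\<^sub>0 x\<^sub>0 z"
    if "z \<in> Xbar" for K z
  proof -
    have "\<mu> * (\<Sum>k<K. expectation (G k)) = expectation (\<lambda>\<omega>. \<mu> * (\<Sum>k<K. G k \<omega>))"
      using intG by simp
    also have "\<dots> \<le> 2 * Lmax\<^sup>2 * Lblock * bregman \<psi> xs\<^sub>0 x\<^sub>0 z"
      using sum_G[OF _ that] intG by (intro integral_le_const AE_I2) auto
    finally have "(\<Sum>k<K. expectation (G k)) \<le> 2 * Lmax\<^sup>2 * Lblock * bregman \<psi> xs\<^sub>0 x\<^sub>0 z / \<mu>"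
      using \<open>\<mu> > 0\<close> by (simp add: pos_le_divide_eq mult.commute)
    then have "L * (\<Sum>k<K. expectation (G k)) \<le> L * (2 * Lmax\<^sup>2 * Lblock * bregman \<psi> xs\<^sub>0 x\<^sub>0 z / \<mu>)"
      using \<open>0 \<le> L\<close> by (rule mult_left_mono)
    moreover have "(\<Sum>k<K. A k) \<le> L * (\<Sum>k<K. expectation (G k))"
      unfolding sum_distrib_left by (intro sum_mono A_le)
    ultimately show ?thesis by (simp add: mult_ac)
  qed
  \<comment> \<open>Passes to the infimum over z. Dividing by the constant needs it positive; if it
    is 0, the single point c already bounds the sum by 0.\<close>
  have A_sum: "(\<Sum>k<K. A k) \<le> 2 * L * Lmax\<^sup>2 * Lblock / \<mu> * W" for K
  proof -
    let ?c = "2 * L * Lmax\<^sup>2 * Lblock / \<mu>"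
    have "0 \<le> ?c" using \<open>0 \<le> L\<close> \<open>0 \<le> Lblock\<close> \<open>\<mu> > 0\<close> by simp
    then consider "?c = 0" | "?c > 0" by linarith
    then show ?thesis
    proof cases
      case 1
      show ?thesis using A_sum_bregman[OF \<open>c \<in> Xbar\<close>, of K] unfolding 1 by simp
    next
      case 2
      have "(\<Sum>k<K. A k) / ?c \<le> W"
        unfolding W_def bregman_dist_sq_def
      proof (rule cINF_greatest)
        fix z assume "z \<in> Xbar"
        then show "(\<Sum>k<K. A k) / ?c \<le> bregman \<psi> xs\<^sub>0 x\<^sub>0 z"
          using A_sum_bregman[of z K] unfolding pos_divide_le_eq[OF 2] by (simp only: mult.commute)
      qed (use \<open>c \<in> Xbar\<close> in blast)
      then show ?thesis unfolding pos_divide_le_eq[OF 2] by (simp only: mult.commute)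
    qed
  qed

  \<comment> \<open>Rate for the smallest expected squared gradient\<close>
  have "Min (A ` {0..K - 1}) \<le> 2 * L * Lmax\<^sup>2 * Lblock / (\<mu> * real K) * W"
    if "K \<ge> 1" for K
  proof -
    \<comment> \<open>The minimum is at most the mean; as \<open>K \<ge> 1\<close>, the range
      \<open>{0..K - 1}\<close> is the index set of the sum.\<close>
    have "real K * Min (A ` {0..K - 1}) = (\<Sum>k<K. Min (A ` {0..K - 1}))" by simp
    also have "\<dots> \<le> (\<Sum>k<K. A k)" by (intro sum_mono Min_le) auto
    also have "\<dots> \<le> 2 * L * Lmax\<^sup>2 * Lblock / \<mu> * W" by (rule A_sum)
    finally have "Min (A ` {0..K - 1}) * real K \<le> 2 * L * Lmax\<^sup>2 * Lblock / \<mu> * W"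
      by (simp only: mult.commute)
    moreover have "0 < real K" using that by simp
    ultimately have "Min (A ` {0..K - 1}) \<le> 2 * L * Lmax\<^sup>2 * Lblock / \<mu> * W / real K"
      by (simp only: pos_le_divide_eq)
    then show ?thesis by (simp add: mult_ac)
  qed

  \<comment> \<open>Rate for the averaged iterate under the PL inequality\<close>
  moreover have "expectation (\<lambda>\<omega>. F ((1 / real K) *\<^sub>R (\<Sum>k = 0..K - 1. x k \<omega>)) - Fbar)
      \<le> 4 * L * Lmax\<^sup>2 * Lblock / (\<mu>\<^sup>2 * \<gamma> * real K) * W"
    if "\<gamma> > 0" and PL: "\<forall>z. sqrt (\<gamma> * \<mu> / 2) * sqrt (F z - Fbar) \<le> norm (grad F z)"
      and "K \<ge> 1" for \<gamma> K
  proof -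
    have idx: "{0..K - 1} = {..<K}" using \<open>K \<ge> 1\<close> by auto
    \<comment> \<open>The PL inequality squared, with \<open>Fbar = 0\<close>.\<close>
    have F_le: "F z \<le> 2 / (\<gamma> * \<mu>) * (norm (grad F z))\<^sup>2" for z
    proof -
      have "(sqrt (\<gamma> * \<mu> / 2) * sqrt (F z))\<^sup>2 \<le> (norm (grad F z))\<^sup>2"
        using PL \<open>Fbar = 0\<close> \<open>\<gamma> > 0\<close> \<open>\<mu> > 0\<close> F_nonneg by (intro power_mono) auto
      then have "\<gamma> * \<mu> / 2 * F z \<le> (norm (grad F z))\<^sup>2"
        using \<open>\<gamma> > 0\<close> \<open>\<mu> > 0\<close> F_nonneg by (simp add: power_mult_distrib)
      then show ?thesis using \<open>\<gamma> > 0\<close> \<open>\<mu> > 0\<close> by (simp add: field_simps)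
    qed
    have convF: "convex_on UNIV F"
    proof (rule convex_onI)
      fix s :: real and a b assume s: "0 < s" "s < 1"
      have "(\<Sum>i\<in>{1..m}. f i ((1 - s) *\<^sub>R a + s *\<^sub>R b))
          \<le> (\<Sum>i\<in>{1..m}. (1 - s) * f i a + s * f i b)"
        using s by (intro sum_mono convex_onD[OF conv]) auto
      then have "1 / real m * (\<Sum>i\<in>{1..m}. f i ((1 - s) *\<^sub>R a + s *\<^sub>R b))
          \<le> 1 / real m * (\<Sum>i\<in>{1..m}. (1 - s) * f i a + s * f i b)"
        by (rule mult_left_mono) simp
      then show "F ((1 - s) *\<^sub>R a + s *\<^sub>R b) \<le> (1 - s) * F a + s * F b"
        unfolding F_def avg_fun_def
        by (simp add: sum.distrib sum_distrib_left[symmetric] distrib_left mult.left_commute)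
    qed simp
    let ?c = "2 / (\<gamma> * \<mu>) / real K"
    have "expectation (\<lambda>\<omega>. F ((1 / real K) *\<^sub>R (\<Sum>k = 0..K - 1. x k \<omega>)) - Fbar)
        \<le> expectation (\<lambda>\<omega>. ?c * (\<Sum>k<K. (norm (grad F (x k \<omega>)))\<^sup>2))"
    \<comment> \<open>The average involves several iterates at once, so \<open>int\<close> does not
      cover it; for this rule it suffices that the dominating sum is integrable and
      nonnegative.\<close>
    proof (rule integral_mono')
      show "integrable M (\<lambda>\<omega>. ?c * (\<Sum>k<K. (norm (grad F (x k \<omega>)))\<^sup>2))"
        by (intro integrable_mult_right Bochner_Integration.integrable_sum int)
      fix \<omega>
      \<comment> \<open>Jensen for the convex F with uniform weights 1 / K.\<close>
      have "F (\<Sum>k<K. (1 / real K) *\<^sub>R x k \<omega>) \<le> (\<Sum>k<K. 1 / real K * F (x k \<omega>))"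
        using \<open>K \<ge> 1\<close> by (intro convex_on_sum[OF _ _ convF]) (auto simp: lessThan_empty_iff)
      also have "\<dots> \<le> (\<Sum>k<K. 1 / real K * (2 / (\<gamma> * \<mu>) * (norm (grad F (x k \<omega>)))\<^sup>2))"
        by (intro sum_mono mult_left_mono F_le) simp
      finally show "F ((1 / real K) *\<^sub>R (\<Sum>k = 0..K - 1. x k \<omega>)) - Fbar
          \<le> ?c * (\<Sum>k<K. (norm (grad F (x k \<omega>)))\<^sup>2)"
        unfolding idx \<open>Fbar = 0\<close> by (simp add: scaleR_sum_right sum_distrib_left mult_ac)
      show "0 \<le> ?c * (\<Sum>k<K. (norm (grad F (x k \<omega>)))\<^sup>2)"
        using \<open>\<gamma> > 0\<close> \<open>\<mu> > 0\<close> by (intro mult_nonneg_nonneg sum_nonneg) auto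
    qed
    also have "\<dots> = ?c * (\<Sum>k<K. A k)"
      unfolding A_def using int[of "\<lambda>z. (norm (grad F z))\<^sup>2"] by simp
    also have "\<dots> \<le> ?c * (2 * L * Lmax\<^sup>2 * Lblock / \<mu> * W)"
      using \<open>\<gamma> > 0\<close> \<open>\<mu> > 0\<close> by (intro mult_left_mono A_sum) auto
    also have "\<dots> = 4 * L * Lmax\<^sup>2 * Lblock / (\<mu>\<^sup>2 * \<gamma> * real K) * W"
      by (simp add: power2_eq_square mult_ac)
    finally show ?thesis .
  qed
  ultimately show ?thesis unfolding A_def[abs_def] W_def by blast
qed

end
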